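(* Let $\alpha>0$ and let $\varphi,\psi:B^3\times I\to\mathbb{R}^3$ be continuous maps, written $\varphi(x,t),\psi(x,t)$, such that: (1) $\varphi$ and $\psi$ are $\alpha$-Hölder with respect to $t$; (2) for any $t,s\in I$ the function $x\mapsto f(x,t,s)=\varphi(x,t)-\psi(x,s)$ is bi-Lipschitz on $B^3$. Then the Hausdorff dimension of the set $\Delta=\{x\in B^3 : \varphi(x,I)\cap\psi(x,I)\neq\varnothing\}$ does not exceed $2/\alpha$.
   Context: $B^3$ is a ball in $\mathbb{R}^3$ and $I=[0,1]$. Here $\varphi(x,I)=\{\varphi(x,t):t\in I\}$, and similarly for $\psi$. "$\alpha$-Hölder with respect to $t$" means: for each $x\in B^3$ there is a constant $M$ with $\|\varphi(x,t)-\varphi(x,t')\|\le M|t-t'|^\alpha$ for all $t,t'\in I$, and similarly for $\psi$. A map $h:B^3\to\mathbb{R}^3$ is bi-Lipschitz if there is $L\ge 1$ with $L^{-1}\|x-y\|\le\|h(x)-h(y)\|\le L\|x-y\|$ for all $x,y\in B^3$. *)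

theory Defs
  imports "HOL-Analysis.Analysis"
begin

definition holder_on :: "real \<Rightarrow> 'a::metric_space set \<Rightarrow> ('a \<Rightarrow> 'b::real_normed_vector) \<Rightarrow> bool"
  where "holder_on \<alpha> S g \<longleftrightarrow>
    (\<exists>M. \<forall>t\<in>S. \<forall>t'\<in>S. norm (g t - g t') \<le> M * dist t t' powr \<alpha>)"

definition bilipschitz_on ::
    "'a::real_normed_vector set \<Rightarrow> ('a \<Rightarrow> 'b::real_normed_vector) \<Rightarrow> bool"
  where "bilipschitz_on S h \<longleftrightarrow>
    (\<exists>L\<ge>1. \<forall>x\<in>S. \<forall>y\<in>S.
       inverse L * norm (x - y) \<le> norm (h x - h y) \<and> norm (h x - h y) \<le> L * norm (x - y))"

(* The s-th power of the diameter, with the usual conventions that the empty set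
   contributes 0 and that every nonempty set contributes 1 for s = 0
   (whereas 0 powr 0 = 0 in the library). Meant for bounded U only, because
   diameter U is an unspecified real number for unbounded U. *)
definition diam_power :: "real \<Rightarrow> 'a::metric_space set \<Rightarrow> real"
  where "diam_power s U =
    (if U = {} then 0 else if s = 0 then 1 else diameter U powr s)"

(* Covers are sequences; finite covers are included by padding with empty sets. *)
definition hausdorff_premeasure :: "real \<Rightarrow> real \<Rightarrow> 'a::metric_space set \<Rightarrow> ennreal"
  where "hausdorff_premeasure s \<delta> A =
    (INF U \<in> {U :: nat \<Rightarrow> 'a set.
        A \<subseteq> (\<Union>i. U i) \<and> (\<forall>i. bounded (U i) \<and> diameter (U i) \<le> \<delta>)}.
      \<Sum>i. ennreal (diam_power s (U i)))"

(* The supremum over \<delta> > 0 is the limit as \<delta> tends to 0, by monotonicity. *)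
definition hausdorff_measure :: "real \<Rightarrow> 'a::metric_space set \<Rightarrow> ennreal"
  where "hausdorff_measure s A = (SUP \<delta>\<in>{0<..}. hausdorff_premeasure s \<delta> A)"

definition hausdorff_dim :: "'a::metric_space set \<Rightarrow> ennreal"
  where "hausdorff_dim A = Inf {ennreal s | s. 0 \<le> s \<and> hausdorff_measure s A = 0}"

end

theory Submission
  imports Defs
begin

text \<open>
  Every point \<open>x\<close> of the exceptional set \<open>\<Delta>\<close> has parameters \<open>(t, u)\<close> in the unit square with
  \<open>\<phi> x t = \<psi> x u\<close>; choose one such pair \<open>p x\<close> for each \<open>x\<close>. If \<open>y\<close> is another point
  of \<open>\<Delta>\<close> and \<open>p y = (t', u')\<close>, then \<open>f(\<cdot>, t, u)\<close> vanishes at \<open>x\<close>, and at \<open>y\<close> it equals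
  \<open>(\<phi> y t - \<phi> y t') - (\<psi> y u - \<psi> y u')\<close>. The lower Lipschitz bound of \<open>f(\<cdot>, t, u)\<close> and the
  Hoelder bounds at \<open>y\<close> therefore give
  \<open>norm (x - y) \<le> L * (M * \<bar>t - t'\<bar> powr \<alpha> + M' * \<bar>u - u'\<bar> powr \<alpha>)\<close>.
  So \<open>p\<close> is injective with an \<open>\<alpha>\<close>-Hoelder inverse, except that \<open>L\<close> depends on \<open>p x\<close> and
  \<open>M\<close>, \<open>M'\<close> depend on \<open>y\<close>. This dependence is harmless: \<open>\<Delta>\<close> is the countable union over
  \<open>n\<close> of the sets where all three constants are at most \<open>n\<close>, and null sets of an outer
  measure are closed under countable unions, however irregular they are
  (\<open>hausdorff_measure_UN_eq_0\<close>).

  On each piece a grid of mesh \<open>1 / N\<close> in the square yields about \<open>N\<^sup>2\<close> sets of diameter of order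
  \<open>N powr - \<alpha>\<close>, whose \<open>s\<close>-th powers sum to order \<open>N powr (2 - \<alpha> * s)\<close>. This tends to zero
  for \<open>s > 2 / \<alpha>\<close> (\<open>hausdorff_measure_eq_0_if_square_coded\<close>).
\<close>

section \<open>Null sets of Hausdorff measures\<close>

lemma hausdorff_measure_eq_0I:
  fixes A :: "'a::metric_space set"
  assumes "\<And>\<delta> \<epsilon> :: real. 0 < \<delta> \<Longrightarrow> 0 < \<epsilon> \<Longrightarrow>
    \<exists>U :: nat \<Rightarrow> 'a set. A \<subseteq> (\<Union>i. U i) \<and> (\<forall>i. bounded (U i) \<and> diameter (U i) \<le> \<delta>) \<and>
      (\<Sum>i. ennreal (diam_power s (U i))) \<le> ennreal \<epsilon>"
  shows "hausdorff_measure s A = 0"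
proof -
  have "hausdorff_premeasure s \<delta> A \<le> 0" if "0 < \<delta>" for \<delta>
  proof (rule ennreal_le_epsilon)
    fix \<epsilon> :: real assume "0 < \<epsilon>"
    then obtain U :: "nat \<Rightarrow> 'a set" where U: "A \<subseteq> (\<Union>i. U i)"
      "\<forall>i. bounded (U i) \<and> diameter (U i) \<le> \<delta>"
      "(\<Sum>i. ennreal (diam_power s (U i))) \<le> ennreal \<epsilon>"
      using assms \<open>0 < \<delta>\<close> by blast
    have "hausdorff_premeasure s \<delta> A \<le> (\<Sum>i. ennreal (diam_power s (U i)))"
      unfolding hausdorff_premeasure_def using U by (intro INF_lower) auto
    then show "hausdorff_premeasure s \<delta> A \<le> 0 + ennreal \<epsilon>"
      using U(3) by simp
  qed
  then have "hausdorff_measure s A \<le> 0"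
    unfolding hausdorff_measure_def by (intro SUP_least) auto
  then show ?thesis by simp
qed

lemma hausdorff_measure_eq_0D:
  fixes A :: "'a::metric_space set" and \<delta> \<epsilon> :: real
  assumes "hausdorff_measure s A = 0" "0 < \<delta>" "0 < \<epsilon>"
  shows "\<exists>U :: nat \<Rightarrow> 'a set. A \<subseteq> (\<Union>i. U i) \<and>
    (\<forall>i. bounded (U i) \<and> diameter (U i) \<le> \<delta>) \<and>
    (\<Sum>i. ennreal (diam_power s (U i))) < ennreal \<epsilon>"
proof -
  have "hausdorff_premeasure s \<delta> A \<le> hausdorff_measure s A"
    unfolding hausdorff_measure_def using assms(2) by (intro SUP_upper) auto
  then have "hausdorff_premeasure s \<delta> A < ennreal \<epsilon>"
    using assms by (simp add: order_le_less_trans)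
  then show ?thesis
    unfolding hausdorff_premeasure_def INF_less_iff by blast
qed

lemma hausdorff_measure_UN_eq_0:
  fixes A :: "nat \<Rightarrow> 'a::metric_space set"
  assumes "\<And>n. hausdorff_measure s (A n) = 0"
  shows "hausdorff_measure s (\<Union>n. A n) = 0"
proof (rule hausdorff_measure_eq_0I)
  fix \<delta> \<epsilon> :: real assume "0 < \<delta>" "0 < \<epsilon>"
  have "\<exists>U :: nat \<Rightarrow> 'a set. A n \<subseteq> (\<Union>i. U i) \<and>
      (\<forall>i. bounded (U i) \<and> diameter (U i) \<le> \<delta>) \<and>
      (\<Sum>i. ennreal (diam_power s (U i))) < ennreal (\<epsilon> * (1 / 2) ^ Suc n)" for n
    using hausdorff_measure_eq_0D[OF assms \<open>0 < \<delta>\<close>] \<open>0 < \<epsilon>\<close> by simp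
  then obtain U :: "nat \<Rightarrow> nat \<Rightarrow> 'a set" where U:
    "\<And>n. A n \<subseteq> (\<Union>i. U n i)"
    "\<And>n i. bounded (U n i) \<and> diameter (U n i) \<le> \<delta>"
    "\<And>n. (\<Sum>i. ennreal (diam_power s (U n i))) < ennreal (\<epsilon> * (1 / 2) ^ Suc n)"
    by metis
  define V where "V k = (case prod_decode k of (n, i) \<Rightarrow> U n i)" for k
  have V_encode: "V (prod_encode (n, i)) = U n i" for n i
    by (simp add: V_def)
  have "(\<Union>n. A n) \<subseteq> (\<Union>k. V k)"
  proof
    fix x assume "x \<in> (\<Union>n. A n)"
    then obtain n i where "x \<in> U n i" using U(1) by blast
    then show "x \<in> (\<Union>k. V k)" using V_encode by blast
  qed
  moreover have "\<forall>k. bounded (V k) \<and> diameter (V k) \<le> \<delta>"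
    using U(2) by (auto simp: V_def split: prod.splits)
  moreover have "(\<Sum>k. ennreal (diam_power s (V k))) \<le> ennreal \<epsilon>"
  proof -
    have "(\<Sum>k. ennreal (diam_power s (V k)))
        = (\<Sum>k. (\<lambda>(n, i). ennreal (diam_power s (U n i))) (prod_decode k))"
      by (simp add: V_def case_prod_beta)
    also have "\<dots> = (\<Sum>n. \<Sum>i. ennreal (diam_power s (U n i)))"
      by (rule suminf_ennreal_2dimen) simp
    also have "\<dots> \<le> (\<Sum>n. ennreal (\<epsilon> * (1 / 2) ^ Suc n))"
      using U(3) by (intro suminf_le) (auto intro: less_imp_le)
    also have "\<dots> = ennreal \<epsilon>"
    proof (rule suminf_ennreal_eq)
      show "(\<lambda>n. \<epsilon> * (1 / 2) ^ Suc n) sums \<epsilon>"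
        using sums_mult[OF power_half_series, of \<epsilon>] by simp
    qed (use \<open>0 < \<epsilon>\<close> in simp)
    finally show ?thesis .
  qed
  ultimately show "\<exists>U :: nat \<Rightarrow> 'a set. (\<Union>n. A n) \<subseteq> (\<Union>i. U i) \<and>
      (\<forall>i. bounded (U i) \<and> diameter (U i) \<le> \<delta>) \<and>
      (\<Sum>i. ennreal (diam_power s (U i))) \<le> ennreal \<epsilon>"
    by blast
qed

lemma hausdorff_dim_leI:
  assumes "0 \<le> d" "\<And>s. d < s \<Longrightarrow> hausdorff_measure s A = 0"
  shows "hausdorff_dim A \<le> ennreal d"
proof (rule ennreal_le_epsilon)
  fix \<epsilon> :: real assume "0 < \<epsilon>"
  then have "hausdorff_dim A \<le> ennreal (d + \<epsilon>)"
    unfolding hausdorff_dim_def using assms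
    by (intro Inf_lower CollectI exI[of _ "d + \<epsilon>"] conjI refl) auto
  then show "hausdorff_dim A \<le> ennreal d + ennreal \<epsilon>"
    using assms(1) \<open>0 < \<epsilon>\<close> by (simp add: ennreal_plus)
qed

section \<open>Sets coded by the unit square\<close>

lemma diam_power_le:
  assumes "0 < s" "0 \<le> d" "\<And>x y. x \<in> U \<Longrightarrow> y \<in> U \<Longrightarrow> dist x y \<le> d"
  shows "bounded U \<and> diameter U \<le> d \<and> diam_power s U \<le> d powr s"
proof -
  have bdd: "bounded U"
    unfolding bounded_def using assms(3) by (metis equals0I empty_iff)
  have diam: "diameter U \<le> d"
    unfolding diameter_def using assms(2,3) by (auto intro!: cSUP_least)
  have "diam_power s U \<le> d powr s"
    using assms(1) diam diameter_ge_0[OF bdd] by (auto simp: diam_power_def intro: powr_mono2)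
  with bdd diam show ?thesis by simp
qed

text \<open>
  The product bounds the cover by grid cells of mesh \<open>1 / N\<close>: cells have diameter at most \<open>2 / N\<close>,
  the Hoelder bound turns this into the diameter of a piece, and \<open>(N + 1)\<^sup>2\<close> counts the cells.
\<close>

lemma grid_cover_sum_tendsto_0:
  fixes C \<alpha> s :: real
  assumes "2 < \<alpha> * s"
  shows "(\<lambda>N. (real N + 1)\<^sup>2 * (C * (2 / real N) powr \<alpha>) powr s) \<longlonglongrightarrow> 0"
proof -
  define K where "K = (C * 2 powr \<alpha>) powr s"
  have "(\<lambda>N. K * ((1 + 1 / real N)\<^sup>2 * real N powr (2 - \<alpha> * s))) \<longlonglongrightarrow> K * ((1 + 0)\<^sup>2 * 0)"
    using assms
    by (intro tendsto_intros lim_1_over_n tendsto_neg_powr filterlim_real_sequentially) auto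
  moreover have "\<forall>\<^sub>F N in sequentially.
      K * ((1 + 1 / real N)\<^sup>2 * real N powr (2 - \<alpha> * s))
        = (real N + 1)\<^sup>2 * (C * (2 / real N) powr \<alpha>) powr s"
    using eventually_gt_at_top[of 0]
  proof eventually_elim
    case (elim N)
    have "C * (2 / real N) powr \<alpha> = (C * 2 powr \<alpha>) * real N powr - \<alpha>"
      by (simp add: powr_divide powr_minus_divide)
    then have "(C * (2 / real N) powr \<alpha>) powr s = ((C * 2 powr \<alpha>) * real N powr - \<alpha>) powr s"
      by (simp only:)
    also have "\<dots> = K * (real N powr - \<alpha>) powr s"
      unfolding K_def by (rule powr_mult)
    also have "\<dots> = K * real N powr - (\<alpha> * s)"
      by (simp add: powr_powr)
    finally have "(C * (2 / real N) powr \<alpha>) powr s = K * real N powr - (\<alpha> * s)" .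
    moreover have "(real N + 1)\<^sup>2 = (1 + 1 / real N)\<^sup>2 * real N powr 2"
      using elim by (simp add: power_mult_distrib[symmetric] distrib_right add.commute)
    moreover have "real N powr (2 - \<alpha> * s) = real N powr 2 * real N powr - (\<alpha> * s)"
      using powr_add[of "real N" 2 "- (\<alpha> * s)"] by simp
    ultimately show ?case
      by simp
  qed
  ultimately show ?thesis
    by (simp add: tendsto_cong)
qed

text \<open>
  The hypothesis says that \<open>p\<close> is injective on \<open>A\<close> and that its inverse is an \<open>\<alpha>\<close>-Hoelder map
  from a subset of the square onto \<open>A\<close>. It is phrased through \<open>p\<close> because a coding of points by
  parameters can simply be chosen, without first showing that the parameters determine the point.
  The pieces of \<open>A\<close> coded by the cells of a grid form an efficient cover.
\<close>

lemma hausdorff_measure_eq_0_if_square_coded: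
  fixes A :: "'a::metric_space set" and p :: "'a \<Rightarrow> real \<times> real"
  assumes "0 < \<alpha>" "2 / \<alpha> < s" "0 \<le> C"
    and p_in: "\<And>x. x \<in> A \<Longrightarrow> p x \<in> {0..1} \<times> {0..1}"
    and holder: "\<And>x y. x \<in> A \<Longrightarrow> y \<in> A \<Longrightarrow> dist x y \<le> C * dist (p x) (p y) powr \<alpha>"
  shows "hausdorff_measure s A = 0"
proof (rule hausdorff_measure_eq_0I)
  fix \<delta> \<epsilon> :: real assume "0 < \<delta>" "0 < \<epsilon>"
  have "2 < \<alpha> * s"
    using assms(1,2) by (simp add: pos_divide_less_eq mult.commute)
  have "0 < 2 / \<alpha>"
    using assms(1) by simp
  then have "0 < s"
    using assms(2) by linarith
  define d where "d N = C * (2 / real N) powr \<alpha>" for N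
  have "(\<lambda>N. (2 / real N) powr \<alpha>) \<longlonglongrightarrow> 0"
    using assms(1)
    by (intro tendsto_zero_powrI[where b = \<alpha>] lim_const_over_n tendsto_const) auto
  then have "d \<longlonglongrightarrow> 0"
    unfolding d_def by (rule tendsto_mult_right_zero)
  then have "\<forall>\<^sub>F N in sequentially. d N < \<delta>"
    using \<open>0 < \<delta>\<close> by (rule order_tendstoD)
  moreover have "\<forall>\<^sub>F N in sequentially. (real N + 1)\<^sup>2 * d N powr s < \<epsilon>"
    unfolding d_def
    using grid_cover_sum_tendsto_0[OF \<open>2 < \<alpha> * s\<close>] \<open>0 < \<epsilon>\<close> by (rule order_tendstoD)
  ultimately have "\<forall>\<^sub>F N in sequentially. d N < \<delta> \<and> (real N + 1)\<^sup>2 * d N powr s < \<epsilon> \<and> 0 < N"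
    using eventually_gt_at_top[of "0::nat"] by eventually_elim simp
  then obtain N where N: "d N < \<delta>" "(real N + 1)\<^sup>2 * d N powr s < \<epsilon>" "0 < N"
    using eventually_happens trivial_limit_sequentially by blast
  have "0 \<le> d N"
    using assms(3) by (simp add: d_def)
  define cell where "cell x = (nat \<lfloor>N * fst (p x)\<rfloor>, nat \<lfloor>N * snd (p x)\<rfloor>)" for x
  define U where "U k = {x \<in> A. cell x = prod_decode k}" for k
  have dist_U: "dist x y \<le> d N" if "x \<in> U k" "y \<in> U k" for k x y
  proof -
    have xy: "x \<in> A" "y \<in> A" "cell x = cell y"
      using that by (auto simp: U_def)
    have close: "\<bar>a - b\<bar> \<le> 1 / N" if "nat \<lfloor>N * a\<rfloor> = nat \<lfloor>N * b\<rfloor>" "0 \<le> a" "0 \<le> b" for a b :: real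
    proof -
      have "\<lfloor>N * a\<rfloor> = \<lfloor>N * b\<rfloor>"
        using that by (simp add: eq_nat_nat_iff)
      then have "\<bar>N * a - N * b\<bar> \<le> 1"
        by linarith
      then have "N * \<bar>a - b\<bar> \<le> 1"
        by (simp add: abs_mult right_diff_distrib[symmetric])
      then show ?thesis
        using \<open>0 < N\<close> by (simp add: field_simps)
    qed
    have "dist (p x) (p y) \<le> \<bar>fst (p x) - fst (p y)\<bar> + \<bar>snd (p x) - snd (p y)\<bar>"
      unfolding dist_prod_def dist_real_def
      by (rule order_trans[OF sqrt_sum_squares_le_sum_abs]) simp
    also have "\<dots> \<le> 1 / N + 1 / N"
      using p_in[OF xy(1)] p_in[OF xy(2)] xy(3)
      by (intro add_mono close) (auto simp: cell_def mem_Times_iff)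
    finally have "dist (p x) (p y) \<le> 2 / N"
      by simp
    then have "C * dist (p x) (p y) powr \<alpha> \<le> d N"
      unfolding d_def using assms(1,3) by (intro mult_left_mono powr_mono2) auto
    then show ?thesis
      using holder[OF xy(1,2)] by simp
  qed
  have diam_U: "bounded (U k) \<and> diameter (U k) \<le> d N \<and> diam_power s (U k) \<le> d N powr s" for k
    by (rule diam_power_le[OF \<open>0 < s\<close> \<open>0 \<le> d N\<close>]) (rule dist_U)
  (* The floors run up to N inclusive, because a coordinate may equal 1. *)
  define J where "J = prod_encode ` ({..N} \<times> {..N})"
  have "finite J"
    by (simp add: J_def)
  have card_J: "card J = (N + 1)\<^sup>2"
    by (simp add: J_def card_image[OF inj_prod_encode] power2_eq_square)
  have U_empty: "U k = {}" if "k \<notin> J" for k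
  proof -
    have "nat \<lfloor>N * a\<rfloor> \<le> N" if "0 \<le> a" "a \<le> 1" for a :: real
    proof -
      have "N * a \<le> N"
        using that by (simp add: mult_left_le)
      then have "\<lfloor>N * a\<rfloor> \<le> int N"
        by linarith
      then show ?thesis
        by linarith
    qed
    then have cell_in: "cell x \<in> {..N} \<times> {..N}" if "x \<in> A" for x
      using p_in[OF that] by (auto simp: cell_def mem_Times_iff)
    have "prod_decode k \<notin> {..N} \<times> {..N}"
      using that unfolding J_def by (metis imageI prod_decode_inverse)
    then have "cell x \<noteq> prod_decode k" if "x \<in> A" for x
      using cell_in[OF that] by metis
    then show ?thesis
      unfolding U_def by blast
  qed
  have "A \<subseteq> (\<Union>k. U k)"
  proof
    fix x assume "x \<in> A"
    then have "x \<in> U (prod_encode (cell x))" by (simp add: U_def)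
    then show "x \<in> (\<Union>k. U k)" by blast
  qed
  moreover have "\<forall>k. bounded (U k) \<and> diameter (U k) \<le> \<delta>"
    using diam_U N(1) by (meson less_imp_le order_trans)
  moreover have "(\<Sum>k. ennreal (diam_power s (U k))) \<le> ennreal \<epsilon>"
  proof -
    have "(\<Sum>k. ennreal (diam_power s (U k))) = (\<Sum>k\<in>J. ennreal (diam_power s (U k)))"
      using \<open>finite J\<close> U_empty by (intro suminf_finite) (auto simp: diam_power_def)
    also have "\<dots> \<le> (\<Sum>k\<in>J. ennreal (d N powr s))"
      using diam_U by (intro sum_mono ennreal_leI) blast
    also have "\<dots> = ennreal (\<Sum>k\<in>J. d N powr s)"
      by (rule sum_ennreal) simp
    also have "\<dots> = ennreal ((real N + 1)\<^sup>2 * d N powr s)"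
      by (simp add: card_J add.commute)
    also have "\<dots> \<le> ennreal \<epsilon>"
      using N(2) by (intro ennreal_leI) simp
    finally show ?thesis .
  qed
  ultimately show "\<exists>U :: nat \<Rightarrow> 'a set. A \<subseteq> (\<Union>i. U i) \<and>
      (\<forall>i. bounded (U i) \<and> diameter (U i) \<le> \<delta>) \<and>
      (\<Sum>i. ennreal (diam_power s (U i))) \<le> ennreal \<epsilon>"
    by blast
qed

section \<open>Parameters of common points\<close>

text \<open>
  The lower bilipschitz bound is used with the parameters of \<open>x\<close>, and the Hoelder bounds at the
  other point \<open>y\<close>; hence only one of the two points enters each constant.
\<close>

lemma norm_diff_le_of_common_points:
  fixes \<phi> \<psi> :: "'a::real_normed_vector \<Rightarrow> real \<Rightarrow> 'b::real_normed_vector"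
  assumes "0 < \<alpha>" "0 < L" "0 \<le> M"
    and lower: "inverse L * norm (x - y) \<le> norm ((\<phi> x t - \<psi> x u) - (\<phi> y t - \<psi> y u))"
    and "norm (\<phi> y t - \<phi> y t') \<le> M * dist t t' powr \<alpha>"
    and "norm (\<psi> y u - \<psi> y u') \<le> M * dist u u' powr \<alpha>"
    and common: "\<phi> x t = \<psi> x u" "\<phi> y t' = \<psi> y u'"
  shows "norm (x - y) \<le> 2 * L * M * dist (t, u) (t', u') powr \<alpha>"
proof -
  define r where "r = dist (t, u) (t', u') powr \<alpha>"
  have r: "dist t t' powr \<alpha> \<le> r" "dist u u' powr \<alpha> \<le> r"
    unfolding r_def using \<open>0 < \<alpha>\<close> dist_fst_le[of "(t, u)" "(t', u')"] dist_snd_le[of "(t, u)" "(t', u')"]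
    by (auto intro!: powr_mono2)
  have "norm ((\<phi> x t - \<psi> x u) - (\<phi> y t - \<psi> y u)) = norm ((\<psi> y u - \<psi> y u') - (\<phi> y t - \<phi> y t'))"
    using common by (simp add: algebra_simps)
  also have "\<dots> \<le> M * dist u u' powr \<alpha> + M * dist t t' powr \<alpha>"
    using assms(5,6) norm_triangle_ineq4 by (smt (verit))
  also have "\<dots> \<le> M * r + M * r"
    using r \<open>0 \<le> M\<close> by (intro add_mono mult_left_mono)
  finally have "inverse L * norm (x - y) \<le> 2 * M * r"
    using lower by simp
  then show ?thesis
    using \<open>0 < L\<close> by (simp add: r_def field_simps)
qed

theorem theorem2:
  fixes \<alpha> r :: real and c :: "real ^ 3" and B :: "(real ^ 3) set"
    and \<phi> \<psi> :: "real ^ 3 \<Rightarrow> real \<Rightarrow> real ^ 3"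
  assumes "\<alpha> > 0"
    and "r > 0" and "B = ball c r \<or> B = cball c r"
    and "continuous_on (B \<times> {0..1}) (\<lambda>(x, t). \<phi> x t)"
    and "continuous_on (B \<times> {0..1}) (\<lambda>(x, t). \<psi> x t)"
    and "\<forall>x\<in>B. holder_on \<alpha> {0..1} (\<phi> x)"
    and "\<forall>x\<in>B. holder_on \<alpha> {0..1} (\<psi> x)"
    and "\<forall>t\<in>{0..1}. \<forall>s\<in>{0..1}. bilipschitz_on B (\<lambda>x. \<phi> x t - \<psi> x s)"
  shows "hausdorff_dim {x \<in> B. \<phi> x ` {0..1} \<inter> \<psi> x ` {0..1} \<noteq> {}} \<le> ennreal (2 / \<alpha>)"
proof (rule hausdorff_dim_leI)
  show "0 \<le> 2 / \<alpha>"
    using \<open>\<alpha> > 0\<close> by simp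
next
  fix s assume s: "2 / \<alpha> < s"
  define \<Delta> where "\<Delta> = {x \<in> B. \<phi> x ` {0..1} \<inter> \<psi> x ` {0..1} \<noteq> {}}"
  have "\<forall>x\<in>\<Delta>. \<exists>q. q \<in> {0..1} \<times> {0..1} \<and> \<phi> x (fst q) = \<psi> x (snd q)"
    by (fastforce simp: \<Delta>_def)
  then obtain p where p: "\<And>x. x \<in> \<Delta> \<Longrightarrow> p x \<in> {0..1} \<times> {0..1}"
    "\<And>x. x \<in> \<Delta> \<Longrightarrow> \<phi> x (fst (p x)) = \<psi> x (snd (p x))"
    by metis
  (* A common bound for all constants attached to x: the Lipschitz constant at its parameters
     and the two Hoelder constants at x itself. *)
  define good where "good n x \<longleftrightarrow>
    (\<forall>y\<in>B. inverse (real n) * norm (x - y) \<le>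
      norm ((\<phi> x (fst (p x)) - \<psi> x (snd (p x))) - (\<phi> y (fst (p x)) - \<psi> y (snd (p x))))) \<and>
    (\<forall>t\<in>{0..1}. \<forall>t'\<in>{0..1}. norm (\<phi> x t - \<phi> x t') \<le> real n * dist t t' powr \<alpha> \<and>
      norm (\<psi> x t - \<psi> x t') \<le> real n * dist t t' powr \<alpha>)" for n x
  have ex_good: "\<exists>n>0. good n x" if "x \<in> \<Delta>" for x
  proof -
    have "x \<in> B"
      using that by (simp add: \<Delta>_def)
    have "bilipschitz_on B (\<lambda>z. \<phi> z (fst (p x)) - \<psi> z (snd (p x)))"
      using assms(8) p(1)[OF that] by (auto simp: mem_Times_iff)
    then obtain L where L: "1 \<le> L" "\<And>y. y \<in> B \<Longrightarrow> inverse L * norm (x - y) \<le>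
        norm ((\<phi> x (fst (p x)) - \<psi> x (snd (p x))) - (\<phi> y (fst (p x)) - \<psi> y (snd (p x))))"
      unfolding bilipschitz_on_def using \<open>x \<in> B\<close> by blast
    obtain M where M: "\<And>t t'. t \<in> {0..1} \<Longrightarrow> t' \<in> {0..1} \<Longrightarrow>
        norm (\<phi> x t - \<phi> x t') \<le> M * dist t t' powr \<alpha>"
      using assms(6) \<open>x \<in> B\<close> unfolding holder_on_def by blast
    obtain M' where M': "\<And>t t'. t \<in> {0..1} \<Longrightarrow> t' \<in> {0..1} \<Longrightarrow>
        norm (\<psi> x t - \<psi> x t') \<le> M' * dist t t' powr \<alpha>"
      using assms(7) \<open>x \<in> B\<close> unfolding holder_on_def by blast
    obtain n where "max L (max M M') \<le> real n"
      using real_arch_simple by blast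
    then have n: "L \<le> n" "M \<le> n" "M' \<le> n"
      by auto
    have "inverse (real n) * norm (x - y) \<le> inverse L * norm (x - y)" for y
      using L(1) n(1) by (intro mult_right_mono le_imp_inverse_le) auto
    moreover have "M * a powr \<alpha> \<le> n * a powr \<alpha>" "M' * a powr \<alpha> \<le> n * a powr \<alpha>" for a
      using n by (auto intro!: mult_right_mono)
    ultimately have "good n x"
      unfolding good_def using L(2) M M' by (meson order_trans)
    moreover have "0 < n"
      using L(1) n(1) by simp
    ultimately show ?thesis
      by blast
  qed
  have "hausdorff_measure s {x \<in> \<Delta>. 0 < n \<and> good n x} = 0" for n
  proof (rule hausdorff_measure_eq_0_if_square_coded[OF \<open>\<alpha> > 0\<close> s])
    show "0 \<le> 2 * real n * real n"
      by simp
    show "p x \<in> {0..1} \<times> {0..1}" if "x \<in> {x \<in> \<Delta>. 0 < n \<and> good n x}" for x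
      using that p(1) by blast
    show "dist x y \<le> 2 * real n * real n * dist (p x) (p y) powr \<alpha>"
      if xy: "x \<in> {x \<in> \<Delta>. 0 < n \<and> good n x}" "y \<in> {x \<in> \<Delta>. 0 < n \<and> good n x}" for x y
    proof -
      obtain t u t' u' where tu: "p x = (t, u)" "p y = (t', u')"
        by fastforce
      have \<Delta>: "x \<in> \<Delta>" "y \<in> \<Delta>" "y \<in> B" and n: "0 < real n" "good n x" "good n y"
        using xy by (auto simp: \<Delta>_def)
      have sq: "t \<in> {0..1}" "u \<in> {0..1}" "t' \<in> {0..1}" "u' \<in> {0..1}"
        using p(1)[OF \<Delta>(1)] p(1)[OF \<Delta>(2)] tu by auto
      have "norm (x - y) \<le> 2 * real n * real n * dist (t, u) (t', u') powr \<alpha>"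
      proof (rule norm_diff_le_of_common_points)
        show "inverse (real n) * norm (x - y) \<le> norm ((\<phi> x t - \<psi> x u) - (\<phi> y t - \<psi> y u))"
          using n(2) \<Delta>(3) tu(1) unfolding good_def by auto
        show "norm (\<phi> y t - \<phi> y t') \<le> real n * dist t t' powr \<alpha>"
          "norm (\<psi> y u - \<psi> y u') \<le> real n * dist u u' powr \<alpha>"
          using n(3) sq unfolding good_def by blast+
        show "\<phi> x t = \<psi> x u" "\<phi> y t' = \<psi> y u'"
          using p(2)[OF \<Delta>(1)] p(2)[OF \<Delta>(2)] tu by auto
      qed (use \<open>\<alpha> > 0\<close> n(1) in auto)
      then show ?thesis
        by (simp add: dist_norm tu)
    qed
  qed
  then have "hausdorff_measure s (\<Union>n. {x \<in> \<Delta>. 0 < n \<and> good n x}) = 0"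
    by (rule hausdorff_measure_UN_eq_0)
  moreover have "(\<Union>n. {x \<in> \<Delta>. 0 < n \<and> good n x}) = \<Delta>"
    using ex_good by blast
  ultimately show "hausdorff_measure s {x \<in> B. \<phi> x ` {0..1} \<inter> \<psi> x ` {0..1} \<noteq> {}} = 0"
    by (simp add: \<Delta>_def)
qed

end
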